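(* Let $m,n\ge 2$ be integers. There exists a generic semi-algebraic set $\mathbb{S}\subset\mathbb{R}^{[m,n]}\times\mathbb{R}^n$ such that the solution map $\mathrm{Sol}:\mathbb{R}^{[m,n]}\times\mathbb{R}^n\rightrightarrows\mathbb{R}^n$ is finite-valued on $\mathbb{S}$.
   Context: $\mathbb{R}^{[m,n]}\cong\mathbb{R}^{n^m}$ is the real vector space of real $m$-th order $n$-dimensional tensors $\mathcal{A}=(a_{i_1\cdots i_m})$, $i_j\in[n]=\{1,\dots,n\}$. For $x\in\mathbb{R}^n$, $\mathcal{A}x^{m-1}\in\mathbb{R}^n$ has components $(\mathcal{A}x^{m-1})_i=\sum_{i_2,\dots,i_m=1}^n a_{ii_2\cdots i_m}x_{i_2}\cdots x_{i_m}$, and $\mathcal{A}x^m=\langle x,\mathcal{A}x^{m-1}\rangle$. For $a\in\mathbb{R}^n$, $\mathrm{Sol}(\mathcal{A},a)$ is the solution set of the tensor complementarity problem $\mathrm{TCP}(\mathcal{A},a)$, i.e. the set of $x\in\mathbb{R}^n$ with $x\ge 0$, $\mathcal{A}x^{m-1}+a\ge 0$, $\mathcal{A}x^m+\langle x,a\rangle=0$ (inequalities componentwise). The solution map is the set-valued map $(\mathcal{A},a)\mapsto\mathrm{Sol}(\mathcal{A},a)$. A set-valued map $\Psi$ is finite-valued on $S$ if $\Psi(x)$ has finite cardinality for all $x\in S$ (the empty set is allowed). A subset of $\mathbb{R}^N$ is semi-algebraic if it is a finite union of sets of the form $\{x: f_1(x)=\dots=f_\ell(x)=0,\ g_{\ell+1}(x)<0,\dots,g_k(x)<0\}$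 with $f_i,g_j$ real polynomials. A semi-algebraic set $S\subset\mathbb{R}^N$ is generic if it satisfies one of the following properties, which are equivalent for semi-algebraic sets: $S$ is dense in $\mathbb{R}^N$; $\mathbb{R}^N\setminus S$ has Lebesgue measure zero; $\dim(\mathbb{R}^N\setminus S)<N$. *)

theory Defs
  imports "HOL-Analysis.Analysis"
begin

text \<open>
  Order and dimension are carried by finite index types: \<open>'m\<close> is the type of the \<open>m\<close> index
  positions, ordered so that there is a first one, and \<open>'n\<close> stands for \<open>[n]\<close>. A multi-index
  \<open>(i\<^sub>1, \<dots>, i\<^sub>m)\<close> is a function \<open>'m \<Rightarrow> 'n\<close>. Hence a tensor space has dimension \<open>n\<^sup>m\<close>, and it
  inherits its Euclidean structure and Lebesgue measure from the library.
\<close>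

type_synonym ('m, 'n) tensor = "real ^ ('m \<Rightarrow> 'n)"

definition first_pos :: "'m::{finite,linorder}" where
  "first_pos = Min UNIV"

text \<open>The vector \<open>\<A>x\<^sup>m\<^sup>-\<^sup>1\<close>: component \<open>i\<close> sums over the multi-indices whose first entry
  is \<open>i\<close>.\<close>

definition tensor_apply ::
  "('m::{finite,linorder}, 'n::finite) tensor \<Rightarrow> real ^ 'n \<Rightarrow> real ^ 'n" where
  "tensor_apply A x =
     (\<chi> i. \<Sum>j | j first_pos = i. A $ j * (\<Prod>k\<in>UNIV - {first_pos}. x $ j k))"

definition tensor_form ::
  "('m::{finite,linorder}, 'n::finite) tensor \<Rightarrow> real ^ 'n \<Rightarrow> real" where
  "tensor_form A x = x \<bullet> tensor_apply A x"

definition Sol ::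
  "('m::{finite,linorder}, 'n::finite) tensor \<times> (real ^ 'n) \<Rightarrow> (real ^ 'n) set" where
  "Sol = (\<lambda>(A, a). {x. (\<forall>i. 0 \<le> x $ i) \<and> (\<forall>i. 0 \<le> (tensor_apply A x + a) $ i) \<and>
                       tensor_form A x + x \<bullet> a = 0})"

definition finite_valued_on :: "('a \<Rightarrow> 'b set) \<Rightarrow> 'a set \<Rightarrow> bool" where
  "finite_valued_on \<Psi> S \<longleftrightarrow> (\<forall>p\<in>S. finite (\<Psi> p))"

definition basic_semialgebraic :: "'a::euclidean_space set \<Rightarrow> bool" where
  "basic_semialgebraic S \<longleftrightarrow>
     (\<exists>F G. finite F \<and> finite G \<and> (\<forall>f\<in>F \<union> G. real_polynomial_function f) \<and>
            S = {x. (\<forall>f\<in>F. f x = 0) \<and> (\<forall>g\<in>G. g x < 0)})"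

definition semialgebraic :: "'a::euclidean_space set \<Rightarrow> bool" where
  "semialgebraic S \<longleftrightarrow> (\<exists>\<C>. finite \<C> \<and> (\<forall>B\<in>\<C>. basic_semialgebraic B) \<and> S = \<Union>\<C>)"

text \<open>For semi-algebraic sets, density, a null complement, and a complement of smaller dimension
  are equivalent, and any one of them defines genericity. Requiring the first two together
  avoids relying on that equivalence.\<close>

definition generic_semialgebraic :: "'a::euclidean_space set \<Rightarrow> bool" where
  "generic_semialgebraic S \<longleftrightarrow>
     semialgebraic S \<and> closure S = UNIV \<and> - S \<in> null_sets lebesgue"

end

theory Submission
  imports Defs
begin

text \<open>
  A solution of the complementarity problem satisfies the \<open>n\<close> polynomial equations
  \<open>x\<^sub>j ((\<A>x\<^sup>m\<^sup>-\<^sup>1)\<^sub>j + a\<^sub>j) = 0\<close> of degree \<open>m\<close>. Homogenise them with an extra variable \<open>x\<^sub>0\<close> and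
  adjoin \<open>x\<^sub>0\<^sup>m - s x\<^sub>i x\<^sub>0\<^sup>m\<^sup>-\<^sup>1 = 0\<close>. The coefficients of these \<open>n + 1\<close> forms fill a square matrix of
  Macaulay type, which is singular if the forms have a common nontrivial zero, and which is
  the identity if the forms are the pure powers of the variables. Its determinant at \<open>s = 0\<close> is
  therefore a nonzero polynomial in \<open>(\<A>, a)\<close>. Where this polynomial does not vanish, the
  determinant is a nonzero polynomial in \<open>s\<close> that vanishes at \<open>1 / x\<^sub>i\<close> for all solutions \<open>x\<close>
  with \<open>x\<^sub>i \<noteq> 0\<close>. So every coordinate takes finitely many values.
\<close>

section \<open>Zero sets of polynomial functions\<close>

lemma finite_zeros_real_polynomial_function:
  fixes f :: "real \<Rightarrow> real"
  assumes "real_polynomial_function f" "f t0 \<noteq> 0"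
  shows "finite {t. f t = 0}"
proof -
  obtain a n where f: "f = (\<lambda>x. \<Sum>i\<le>n. a i * x ^ i)"
    using assms(1) real_polynomial_function_iff_sum by blast
  then have "\<exists>k\<le>n. a k \<noteq> 0"
    using assms(2) by (force intro: sum.neutral)
  then show ?thesis
    unfolding f using polyfun_finite_roots by blast
qed

text \<open>On every line through \<open>x0\<close> the zeros are finitely many. By Fubini, the preimage of the zero
  set under almost every homothety with centre \<open>x0\<close> is null, and one such homothety suffices.\<close>

lemma negligible_zeros_real_polynomial_function:
  fixes f :: "'a::euclidean_space \<Rightarrow> real"
  assumes poly: "real_polynomial_function f" and nz: "f x0 \<noteq> 0"
  shows "negligible {x. f x = 0}"
proof -
  define g where "g = (\<lambda>c y. f (x0 + c *\<^sub>R (y - x0)))"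
  have cont: "continuous_on X f" for X
    using poly real_polynomial_function_eq continuous_on_polymonial_function by blast
  \<comment> \<open>Joint measurability is what \<open>AE_commute\<close> needs to exchange the two
    quantifiers.\<close>
  have meas: "{p \<in> space (lborel \<Otimes>\<^sub>M lborel). g (fst p) (snd p) \<noteq> 0}
      \<in> sets (lborel \<Otimes>\<^sub>M (lborel :: 'a measure))"
  proof -
    have "continuous_on UNIV (\<lambda>p. g (fst p) (snd p))"
      unfolding g_def by (intro continuous_on_compose2[OF cont[of UNIV]] continuous_intros) auto
    then have "open {p. g (fst p) (snd p) \<noteq> 0}"
      by (simp add: open_Collect_neq)
    moreover have "sets (lborel \<Otimes>\<^sub>M lborel) = sets (borel :: (real \<times> 'a) measure)"
      by (metis borel_prod sets_lborel sets_pair_measure_cong)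
    ultimately show ?thesis by (simp add: space_pair_measure)
  qed
  have fin: "finite {c. g c y = 0}" for y
  proof (rule finite_zeros_real_polynomial_function)
    have "polynomial_function (\<lambda>c. x0 + c *\<^sub>R (y - x0))"
      by (intro polynomial_function_add polynomial_function_const polynomial_function_bounded_linear
          bounded_linear_scaleR_left)
    then show "real_polynomial_function (\<lambda>c. g c y)"
      using poly real_polynomial_function_compose unfolding g_def o_def by fastforce
    \<comment> \<open>Every line passes through \<open>x0\<close> at parameter 0, so one nonzero
      value serves all \<open>y\<close>.\<close>
    show "g 0 y \<noteq> 0" using nz by (simp add: g_def)
  qed
  have "AE y in lborel. AE c in lborel. g c y \<noteq> 0"
  proof (rule AE_I2)
    fix y
    have "{c. g c y = 0} \<in> null_sets lborel"
      using fin finite_imp_null_set_lborel by blast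
    then show "AE c in lborel. g c y \<noteq> 0"
      by (rule AE_I') auto
  qed
  then have "AE c in lborel. AE y in lborel. g c y \<noteq> 0"
    using lborel_pair.AE_commute[OF meas] by simp
  \<comment> \<open>Excluding 0 makes the homothety invertible, so that it reaches every zero of
    \<open>f\<close>.\<close>
  moreover have "AE c in lborel. c \<noteq> (0::real)" by (rule AE_lborel_singleton)
  ultimately have "AE c in lborel. c \<noteq> 0 \<and> (AE y in lborel. g c y \<noteq> 0)"
    by eventually_elim simp
  moreover have "ae_filter (lborel :: real measure) \<noteq> bot"
    by (simp add: ae_filter_eq_bot_iff)
  ultimately obtain c where c: "c \<noteq> 0" "AE y in lborel. g c y \<noteq> 0"
    using eventually_happens' by blast
  have "{y. g c y = 0} \<in> sets lborel"
  proof -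
    have "continuous_on UNIV (g c)"
      unfolding g_def by (intro continuous_on_compose2[OF cont[of UNIV]] continuous_intros) auto
    then have "closed {y. g c y = 0}" by (simp add: closed_Collect_eq)
    then show ?thesis by simp
  qed
  then have "{y. g c y = 0} \<in> null_sets lebesgue"
    using AE_completion[OF c(2)] by (simp add: AE_iff_null_sets)
  then have "negligible ((\<lambda>y. x0 + c *\<^sub>R (y - x0)) ` {y. g c y = 0})"
    by (intro negligible_differentiable_image_negligible)
      (auto simp: negligible_iff_null_sets intro!: derivative_intros)
  moreover have "{x. f x = 0} \<subseteq> (\<lambda>y. x0 + c *\<^sub>R (y - x0)) ` {y. g c y = 0}"
  proof
    fix x assume "x \<in> {x. f x = 0}"
    then show "x \<in> (\<lambda>y. x0 + c *\<^sub>R (y - x0)) ` {y. g c y = 0}"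
      using c(1) by (intro image_eqI[of _ _ "x0 + inverse c *\<^sub>R (x - x0)"]) (auto simp: g_def)
  qed
  ultimately show ?thesis by (rule negligible_subset)
qed

text \<open>The set splits into \<open>f x < 0\<close> and \<open>- f x < 0\<close>. Its complement
  is null, and the complement of its closure is open and null, hence empty.\<close>

lemma generic_semialgebraic_nonzeros:
  fixes f :: "'a::euclidean_space \<Rightarrow> real"
  assumes poly: "real_polynomial_function f" and nz: "f x0 \<noteq> 0"
  shows "generic_semialgebraic {x. f x \<noteq> 0}"
proof -
  have basic: "basic_semialgebraic {x. g x < 0}" if "real_polynomial_function g" for g :: "'a \<Rightarrow> real"
    unfolding basic_semialgebraic_def
    by (rule exI[of _ "{}"], rule exI[of _ "{g}"]) (use that in auto)
  have "basic_semialgebraic {x. - f x < 0}"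
    by (rule basic[OF real_polynomial_function_minus[OF poly]])
  moreover have "{x. f x \<noteq> 0} = \<Union>{{x. f x < 0}, {x. - f x < 0}}" by auto
  ultimately have "semialgebraic {x. f x \<noteq> 0}"
    unfolding semialgebraic_def using basic[OF poly]
    by (intro exI[of _ "{{x. f x < 0}, {x. - f x < 0}}"]) simp
  moreover have null: "- {x. f x \<noteq> 0} \<in> null_sets lebesgue"
    using negligible_zeros_real_polynomial_function[OF assms]
    by (simp add: negligible_iff_null_sets Collect_neg_eq[symmetric])
  moreover have "closure {x. f x \<noteq> 0} = UNIV"
  proof -
    have "negligible (- closure {x. f x \<noteq> 0})"
      using null by (meson Compl_subset_Compl_iff closure_subset negligible_iff_null_sets negligible_subset)
    then show ?thesis
      using open_not_negligible[of "- closure {x. f x \<noteq> 0}"] by auto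
  qed
  ultimately show ?thesis by (simp add: generic_semialgebraic_def)
qed

section \<open>Polynomial dependence of determinants on parameters\<close>

lemma real_polynomial_function_if:
  assumes "real_polynomial_function f" "real_polynomial_function g"
  shows "real_polynomial_function (\<lambda>p. if b then f p else g p)"
  using assms by (cases b) simp_all

lemma real_polynomial_function_det:
  fixes M :: "'a::real_normed_vector \<Rightarrow> real ^ 'k ^ 'k"
  assumes "\<And>u v. real_polynomial_function (\<lambda>p. M p $ u $ v)"
  shows "real_polynomial_function (\<lambda>p. det (M p))"
  unfolding det_def
  by (intro real_polynomial_function_sum real_polynomial_function.intros
      real_polynomial_function_prod assms finite_permutations finite)

section \<open>A Macaulay matrix\<close>

text \<open>A word in the variables \<open>'l\<close> stands for a monomial. Words of this length contain some
  variable at least \<open>CARD('m)\<close> times.\<close>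

lemma ex_constant_subword:
  fixes w :: "'l::finite \<times> 'm::finite \<Rightarrow> 'l"
  shows "\<exists>\<phi>::'m \<Rightarrow> 'l \<times> 'm. inj \<phi> \<and> (\<exists>l. \<forall>k. w (\<phi> k) = l)"
proof -
  have "\<exists>l. CARD('m) \<le> card (w -` {l})"
  proof (rule ccontr)
    assume "\<nexists>l. CARD('m) \<le> card (w -` {l})"
    then have less: "card (w -` {l}) < CARD('m)" for l by (simp add: not_le)
    have "CARD('l \<times> 'm) = card (\<Union>l. w -` {l})" by (rule arg_cong[of _ _ card]) auto
    also have "\<dots> = (\<Sum>l\<in>UNIV. card (w -` {l}))"
      by (rule card_UN_disjoint) auto
    \<comment> \<open>Pigeonhole: a word has exactly \<open>CARD('l) * CARD('m)\<close>
      positions.\<close>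
    also have "\<dots> < (\<Sum>l\<in>(UNIV::'l set). CARD('m))"
      by (rule sum_strict_mono) (auto simp: less)
    finally show False by simp
  qed
  then obtain l and \<phi> :: "'m \<Rightarrow> 'l \<times> 'm" where "\<phi> ` UNIV \<subseteq> w -` {l}" "inj \<phi>"
    by (metis card_le_inj finite)
  then show ?thesis by blast
qed

definition subword :: "('l::finite \<times> 'm::finite \<Rightarrow> 'l) \<Rightarrow> 'm \<Rightarrow> 'l \<times> 'm" where
  "subword w = (SOME \<phi>. inj \<phi> \<and> (\<exists>l. \<forall>k. w (\<phi> k) = l))"

text \<open>The subword is constant, so evaluating it at \<open>undefined\<close> is as good as at
  any other position.\<close>

definition letter :: "('l::finite \<times> 'm::finite \<Rightarrow> 'l) \<Rightarrow> 'l" where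
  "letter w = w (subword w undefined)"

lemma inj_subword: "inj (subword w)"
  and subword_letter: "w (subword w k) = letter w"
proof -
  have *: "inj (subword w) \<and> (\<exists>l. \<forall>k. w (subword w k) = l)"
    unfolding subword_def by (rule someI_ex[OF ex_constant_subword])
  then show "inj (subword w)" by blast
  from * show "w (subword w k) = letter w" by (auto simp: letter_def)
qed

text \<open>Row \<open>w\<close> contains the coefficients of the form \<open>C (letter w)\<close> multiplied by the
  monomial that remains of \<open>w\<close> when its constant subword is removed.\<close>

definition macaulay ::
  "('l::finite \<Rightarrow> ('m::finite \<Rightarrow> 'l) \<Rightarrow> real) \<Rightarrow> real ^ ('l \<times> 'm \<Rightarrow> 'l) ^ ('l \<times> 'm \<Rightarrow> 'l)" where
  "macaulay C = (\<chi> w w'. if \<forall>p. p \<notin> range (subword w) \<longrightarrow> w' p = w p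
                         then C (letter w) (w' \<circ> subword w) else 0)"

text \<open>Row \<open>w\<close> then only admits words that agree with \<open>w\<close> off the
  subword and repeat \<open>letter w\<close> on it, and \<open>w\<close> is the only such word.
  Indexing by words instead of commutative monomials keeps this exact.\<close>

lemma macaulay_pure_powers:
  assumes "\<And>l J. C l J = (if J = (\<lambda>_. l) then 1 else 0)"
  shows "macaulay C = mat 1"
proof -
  have "macaulay C $ w $ w' = mat 1 $ w $ w'" for w w'
  proof -
    have "(\<forall>p. p \<notin> range (subword w) \<longrightarrow> w' p = w p) \<and> w' \<circ> subword w = (\<lambda>_. letter w) \<longleftrightarrow> w = w'"
    proof
      assume *: "(\<forall>p. p \<notin> range (subword w) \<longrightarrow> w' p = w p) \<and> w' \<circ> subword w = (\<lambda>_. letter w)"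
      show "w = w'"
      proof
        fix p show "w p = w' p"
        proof (cases "p \<in> range (subword w)")
          case True
          then obtain k where "p = subword w k" by blast
          then show ?thesis using fun_cong[OF conjunct2[OF *], of k] by (simp add: subword_letter)
        qed (use conjunct1[OF *] in metis)
      qed
    qed (auto intro!: ext simp: subword_letter)
    then show ?thesis
      by (auto simp: macaulay_def mat_def assms)
  qed
  then show ?thesis by (simp add: vec_eq_iff)
qed

lemma real_polynomial_function_det_macaulay:
  assumes "\<And>l J. real_polynomial_function (\<lambda>p. C p l J)"
  shows "real_polynomial_function (\<lambda>p. det (macaulay (C p)))"
proof (rule real_polynomial_function_det)
  show "real_polynomial_function (\<lambda>p. macaulay (C p) $ w $ w')" for w w'
    unfolding macaulay_def vec_lambda_beta
    by (intro real_polynomial_function_if assms real_polynomial_function.intros(2))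
qed

text \<open>The vector of all monomials evaluated at \<open>y\<close> lies in the kernel: row
  \<open>w\<close> yields the value of the form \<open>C (letter w)\<close> times that of the
  remaining monomial. Its entry at the constant word \<open>l0\<close> is a power of
  \<open>y l0\<close>, so it is nonzero.\<close>

lemma det_macaulay_eq_0:
  fixes C :: "'l::finite \<Rightarrow> ('m::finite \<Rightarrow> 'l) \<Rightarrow> real"
  assumes zero: "\<And>l. (\<Sum>J\<in>UNIV. C l J * (\<Prod>k\<in>UNIV. y (J k))) = 0" and nz: "y l0 \<noteq> 0"
  shows "det (macaulay C) = 0"
proof -
  define v :: "real ^ ('l \<times> 'm \<Rightarrow> 'l)" where "v = (\<chi> w. \<Prod>p\<in>UNIV. y (w p))"
  have "(macaulay C *v v) $ w = 0" for w
  proof -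
    define \<phi> where "\<phi> = subword w"
    have inj: "inj \<phi>" by (simp add: \<phi>_def inj_subword)
    define agree where "agree = {w'. \<forall>p. p \<notin> range \<phi> \<longrightarrow> w' p = w p}"
    define R where "R = (\<Prod>p\<in>- range \<phi>. y (w p))"
    \<comment> \<open>Writing \<open>J\<close> into the subword of \<open>w\<close> inverts
      restriction to that subword; this matches \<open>agree\<close> with the index words of the
      form.\<close>
    define ins where "ins = (\<lambda>J p. if p \<in> range \<phi> then J (inv \<phi> p) else w p)"
    have split: "(\<Prod>p\<in>UNIV. y (w' p)) = (\<Prod>k\<in>UNIV. y (w' (\<phi> k))) * R" if "w' \<in> agree" for w'
    proof -
      have "(\<Prod>p\<in>UNIV. y (w' p)) = (\<Prod>p\<in>range \<phi>. y (w' p)) * (\<Prod>p\<in>- range \<phi>. y (w' p))"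
        by (subst prod.union_disjoint[symmetric]) auto
      also have "(\<Prod>p\<in>- range \<phi>. y (w' p)) = R"
        unfolding R_def using that by (intro prod.cong) (auto simp: agree_def)
      also have "(\<Prod>p\<in>range \<phi>. y (w' p)) = (\<Prod>k\<in>UNIV. y (w' (\<phi> k)))"
        by (simp add: prod.reindex[OF inj])
      finally show ?thesis .
    qed
    have "(macaulay C *v v) $ w
        = (\<Sum>w'\<in>UNIV. if w' \<in> agree then C (letter w) (w' \<circ> \<phi>) * (\<Prod>p\<in>UNIV. y (w' p)) else 0)"
      unfolding matrix_vector_mult_def macaulay_def v_def agree_def \<phi>_def
      by (auto intro!: sum.cong)
    also have "\<dots> = (\<Sum>w'\<in>agree. C (letter w) (w' \<circ> \<phi>) * (\<Prod>p\<in>UNIV. y (w' p)))"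
      by (simp add: sum.If_cases)
    also have "\<dots> = (\<Sum>w'\<in>agree. C (letter w) (w' \<circ> \<phi>) * (\<Prod>k\<in>UNIV. y (w' (\<phi> k))) * R)"
      by (intro sum.cong) (auto simp: split)
    also have "\<dots> = (\<Sum>J\<in>UNIV. C (letter w) J * (\<Prod>k\<in>UNIV. y (J k)) * R)"
      by (rule sum.reindex_bij_witness[where i = ins and j = "\<lambda>w'. w' \<circ> \<phi>"])
        (auto simp: ins_def agree_def inj fun_eq_iff)
    also have "\<dots> = 0"
      using zero[of "letter w"] by (simp add: sum_distrib_right[symmetric])
    finally show ?thesis .
  qed
  then have "macaulay C *v v = 0" by (simp add: vec_eq_iff)
  moreover have "v $ (\<lambda>_. l0) \<noteq> 0" by (simp add: v_def nz)
  then have "v \<noteq> 0" by auto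
  ultimately have "\<not> invertible (macaulay C)"
    using matrix_left_invertible_ker invertible_left_inverse by blast
  then show ?thesis by (simp add: invertible_det_nz)
qed

section \<open>The complementarity system\<close>

text \<open>The index \<open>None\<close> stands for the homogenising variable \<open>x\<^sub>0\<close>.\<close>

definition slack_forms ::
  "('m::{finite,linorder}, 'n::finite) tensor \<Rightarrow> real ^ 'n \<Rightarrow> real \<Rightarrow> 'n
    \<Rightarrow> 'n option \<Rightarrow> ('m \<Rightarrow> 'n option) \<Rightarrow> real" where
  "slack_forms A a s i l J =
     (case l of
        None \<Rightarrow> (if J = (\<lambda>_. None) then 1 else 0)
                - s * (if J = (\<lambda>_. None)(first_pos := Some i) then 1 else 0)
      | Some j \<Rightarrow> (if J first_pos = Some j \<and> None \<notin> range J then A $ (the \<circ> J) else 0)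
                + (if J = (\<lambda>_. None)(first_pos := Some j) then a $ j else 0))"

text \<open>These products are nonnegative and sum to the inner product, which vanishes.\<close>

lemma Sol_complementary:
  assumes "x \<in> Sol (A, a)"
  shows "x $ j * (tensor_apply A x + a) $ j = 0"
proof -
  have nn: "0 \<le> x $ i * (tensor_apply A x + a) $ i" for i
    using assms by (auto simp: Sol_def)
  have "(\<Sum>i\<in>UNIV. x $ i * (tensor_apply A x + a) $ i) = x \<bullet> (tensor_apply A x + a)"
    by (simp add: inner_vec_def)
  also have "\<dots> = 0"
    using assms by (simp add: Sol_def tensor_form_def inner_add_right)
  finally show ?thesis
    using nn by (simp add: sum_nonneg_eq_0_iff)
qed

text \<open>The word encodes the product of one variable with a power of the homogenising one,
  evaluated where the latter is 1.\<close>

lemma prod_fun_upd_first: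
  "(\<Prod>k\<in>UNIV. y ((((\<lambda>_. None)(first_pos := l)) :: 'm::{finite,linorder} \<Rightarrow> 'n option) k)) = y l"
  if "y None = (1::real)"
proof -
  have "(\<Prod>k\<in>UNIV. y ((((\<lambda>_. None)(first_pos := l)) :: 'm \<Rightarrow> 'n option) k))
      = (\<Prod>k\<in>(UNIV::'m set). if k = first_pos then y l else 1)"
    using that by (intro prod.cong) auto
  then show ?thesis by simp
qed

text \<open>With the homogenising variable set to 1, the form \<open>Some j\<close> becomes the
  complementarity product for \<open>j\<close>, and the form \<open>None\<close> becomes
  \<open>1 - s * x $ i\<close>.\<close>

lemma slack_forms_zero:
  fixes A :: "('m::{finite,linorder}, 'n::finite) tensor"
  assumes x: "x \<in> Sol (A, a)" and s: "s * x $ i = 1"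
  shows "(\<Sum>J\<in>UNIV. slack_forms A a s i l J * (\<Prod>k\<in>UNIV. case J k of None \<Rightarrow> 1 | Some i \<Rightarrow> x $ i)) = 0"
proof -
  define y where "y = (\<lambda>l. case l of None \<Rightarrow> 1 | Some i \<Rightarrow> x $ i)"
  have y: "y None = 1" "\<And>j. y (Some j) = x $ j" by (auto simp: y_def)
  let ?Y = "\<lambda>J::'m \<Rightarrow> 'n option. \<Prod>k\<in>UNIV. y (J k)"
  have single: "(\<Sum>J\<in>UNIV. (if J = K then c else 0) * ?Y J) = c * ?Y K" for K c
    by (simp add: if_distrib[of "\<lambda>t. t * _"] cong: if_cong)
  have "(\<Sum>J\<in>UNIV. slack_forms A a s i l J * ?Y J) = 0"
  proof (cases l)
    case None
    then have "(\<Sum>J\<in>UNIV. slack_forms A a s i l J * ?Y J)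
        = (\<Sum>J\<in>UNIV. (if J = (\<lambda>_. None) then 1 else 0) * ?Y J)
          - s * (\<Sum>J\<in>UNIV. (if J = (\<lambda>_. None)(first_pos := Some i) then 1 else 0) * ?Y J)"
      by (simp add: slack_forms_def left_diff_distrib sum_subtractf sum_distrib_left mult.assoc)
    also have "\<dots> = 1 - s * x $ i"
      unfolding single by (simp add: prod_fun_upd_first y del: fun_upd_apply)
    finally show ?thesis using s by simp
  next
    case (Some j)
    have "(\<Sum>J\<in>UNIV. (if J first_pos = Some j \<and> None \<notin> range J then A $ (the \<circ> J) else 0) * ?Y J)
        = (\<Sum>J | J first_pos = Some j \<and> None \<notin> range J. A $ (the \<circ> J) * ?Y J)"
      by (simp add: if_distrib[of "\<lambda>t. t * _"] sum.If_cases cong: if_cong)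
    \<comment> \<open>Words without \<open>None\<close> are the multi-indices of the tensor; their
      first letter supplies the factor \<open>x $ j\<close>.\<close>
    also have "\<dots> = (\<Sum>J | J first_pos = j. x $ j * (A $ J * (\<Prod>k\<in>UNIV - {first_pos}. x $ J k)))"
    proof (rule sum.reindex_bij_witness[where i = "\<lambda>J. Some \<circ> J" and j = "\<lambda>J. the \<circ> J"])
      fix J :: "'m \<Rightarrow> 'n option"
      assume J: "J \<in> {J. J first_pos = Some j \<and> None \<notin> range J}"
      then have JS: "J k = Some (the (J k))" for k by (metis (mono_tags) mem_Collect_eq option.collapse rangeI)
      then show "Some \<circ> (the \<circ> J) = J" by (auto simp: fun_eq_iff)
      show "the \<circ> J \<in> {J. J first_pos = j}" using J by simp
      have "?Y J = (\<Prod>k\<in>UNIV. x $ (the (J k)))" using JS y(2) by (metis (no_types, lifting) prod.cong)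
      also have "\<dots> = x $ j * (\<Prod>k\<in>UNIV - {first_pos}. x $ (the (J k)))"
        using J by (simp add: prod.remove[of UNIV first_pos])
      finally show "x $ j * (A $ (the \<circ> J) * (\<Prod>k\<in>UNIV - {first_pos}. x $ (the \<circ> J) k))
          = A $ (the \<circ> J) * ?Y J" by simp
    qed (auto simp: fun_eq_iff)
    also have "\<dots> = x $ j * tensor_apply A x $ j"
      by (simp add: tensor_apply_def sum_distrib_left)
    finally have "(\<Sum>J\<in>UNIV. slack_forms A a s i l J * ?Y J)
        = x $ j * tensor_apply A x $ j
          + (\<Sum>J\<in>UNIV. (if J = (\<lambda>_. None)(first_pos := Some j) then a $ j else 0) * ?Y J)"
      using Some by (simp add: slack_forms_def distrib_right sum.distrib)
    also have "\<dots> = x $ j * tensor_apply A x $ j + a $ j * x $ j"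
      unfolding single by (simp add: prod_fun_upd_first y del: fun_upd_apply)
    also have "\<dots> = 0"
      using Sol_complementary[OF x, of j] by (simp add: algebra_simps)
    finally show ?thesis .
  qed
  then show ?thesis by (simp add: y_def)
qed

text \<open>The diagonal unit tensor, with \<open>a\<close> and \<open>s\<close> zero, is the point
  at which the Macaulay matrix becomes the identity.\<close>

lemma slack_forms_pure_powers:
  "slack_forms (\<chi> J. if \<forall>k. J k = J first_pos then 1 else 0) 0 0 i l J = (if J = (\<lambda>_. l) then 1 else 0)"
proof (cases l)
  case (Some j)
  have "(J first_pos = Some j \<and> None \<notin> range J \<and> (\<forall>k. the (J k) = the (J first_pos)))
      \<longleftrightarrow> J = (\<lambda>_. Some j)"
    by (auto simp: fun_eq_iff) (metis option.collapse option.sel rangeI)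
  moreover have "slack_forms (\<chi> J. if \<forall>k. J k = J first_pos then 1 else 0) 0 0 i l J
      = (if J first_pos = Some j \<and> None \<notin> range J \<and> (\<forall>k. the (J k) = the (J first_pos)) then 1 else 0)"
    by (simp add: Some slack_forms_def del: fun_upd_apply)
  ultimately show ?thesis
    by (simp only: Some)
qed (simp add: slack_forms_def)

section \<open>Finiteness of solution sets and the generic set\<close>

lemma finite_vectors:
  fixes T :: "'n::finite \<Rightarrow> real set"
  assumes "\<And>i. finite (T i)"
  shows "finite {x :: real ^ 'n. \<forall>i. x $ i \<in> T i}"
proof -
  have "finite (vec_lambda ` (PiE UNIV T))"
    by (intro finite_imageI finite_PiE) (simp_all add: assms)
  moreover have "{x :: real ^ 'n. \<forall>i. x $ i \<in> T i} \<subseteq> vec_lambda ` (PiE UNIV T)"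
  proof
    fix x :: "real ^ 'n" assume "x \<in> {x. \<forall>i. x $ i \<in> T i}"
    then show "x \<in> vec_lambda ` (PiE UNIV T)"
      by (intro image_eqI[of _ _ "vec_nth x"]) auto
  qed
  ultimately show ?thesis by (rule finite_subset[rotated])
qed

lemma finite_Sol:
  fixes A :: "('m::{finite,linorder}, 'n::finite) tensor"
  assumes nz: "\<And>i. det (macaulay (slack_forms A a 0 i)) \<noteq> 0"
  shows "finite (Sol (A, a))"
proof -
  \<comment> \<open>The candidates for coordinate \<open>i\<close> are 0 and the reciprocals of the
    roots in \<open>s\<close>; there are finitely many roots because \<open>nz\<close> gives a
    nonzero value at 0.\<close>
  define T where "T = (\<lambda>i. insert 0 (inverse ` {s. det (macaulay (slack_forms A a s i)) = 0}))"
  have "finite (T i)" for i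
  proof -
    have "real_polynomial_function (\<lambda>s. slack_forms A a s i l J)" for l J
      unfolding slack_forms_def
      by (cases l) (auto simp del: fun_upd_apply intro!: real_polynomial_function.intros(2-4)
          real_polynomial_function_diff real_polynomial_function.intros(1)[OF bounded_linear_ident])
    then have "real_polynomial_function (\<lambda>s. det (macaulay (slack_forms A a s i)))"
      by (rule real_polynomial_function_det_macaulay)
    then show ?thesis
      unfolding T_def using finite_zeros_real_polynomial_function nz[of i] by blast
  qed
  moreover have "Sol (A, a) \<subseteq> {x. \<forall>i. x $ i \<in> T i}"
  proof safe
    fix x i assume x: "x \<in> Sol (A, a)"
    show "x $ i \<in> T i"
    proof (cases "x $ i = 0")
      case False
      \<comment> \<open>The common zero is nontrivial because its \<open>None\<close> coordinate is
        1.\<close>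
      then have "det (macaulay (slack_forms A a (inverse (x $ i)) i)) = 0"
        by (intro det_macaulay_eq_0[where y = "\<lambda>l. case l of None \<Rightarrow> 1 | Some i \<Rightarrow> x $ i" and ?l0.0 = None]
            slack_forms_zero x) auto
      then show ?thesis unfolding T_def by (intro insertI2 image_eqI[where x = "inverse (x $ i)"]) auto
    qed (simp add: T_def)
  qed
  ultimately show ?thesis
    using finite_subset[OF _ finite_vectors] by blast
qed

theorem proposition4p1:
  assumes "2 \<le> CARD('m::{finite,linorder})" and "2 \<le> CARD('n::finite)"
  shows "\<exists>S :: (('m, 'n) tensor \<times> (real ^ 'n)) set.
           generic_semialgebraic S \<and> finite_valued_on Sol S"
proof -
  \<comment> \<open>The product over \<open>i\<close> controls all coordinates by one
    polynomial.\<close>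
  define P :: "('m, 'n) tensor \<times> (real ^ 'n) \<Rightarrow> real"
    where "P = (\<lambda>(A, a). \<Prod>i\<in>UNIV. det (macaulay (slack_forms A a 0 i)))"
  have lin: "real_polynomial_function (\<lambda>p::('m, 'n) tensor \<times> (real ^ 'n). fst p $ J)"
    "real_polynomial_function (\<lambda>p::('m, 'n) tensor \<times> (real ^ 'n). snd p $ j)" for J j
    by (auto intro!: real_polynomial_function.intros(1)
        bounded_linear_compose[OF bounded_linear_vec_nth] bounded_linear_fst bounded_linear_snd)
  have "real_polynomial_function (\<lambda>p::('m, 'n) tensor \<times> (real ^ 'n).
      slack_forms (fst p) (snd p) 0 i l J)" for i l J
    unfolding slack_forms_def
    by (cases l) (auto simp del: fun_upd_apply intro!: real_polynomial_function.intros(2-4)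
        real_polynomial_function_if lin)
  then have "real_polynomial_function P"
    unfolding P_def case_prod_beta
    by (intro real_polynomial_function_prod real_polynomial_function_det_macaulay) simp_all
  moreover have "P (\<chi> J. if \<forall>k. J k = J first_pos then 1 else 0, 0) \<noteq> 0"
    unfolding P_def by (simp add: macaulay_pure_powers slack_forms_pure_powers)
  ultimately have "generic_semialgebraic {p. P p \<noteq> 0}"
    by (rule generic_semialgebraic_nonzeros)
  moreover have "finite_valued_on Sol {p. P p \<noteq> 0}"
    unfolding finite_valued_on_def P_def by (auto intro: finite_Sol)
  ultimately show ?thesis by blast
qed

end
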